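(* Let $p,q:\mathbb{R}\to\mathbb{R}$ be $2\pi$-periodic functions with $p(x)>0$, $q(x)\ge 0$ and $\overline q>0$, and suppose there is $\omega_{\max}$ such that the Fourier coefficients satisfy $\hat p(\omega)=0$ and $\hat q(\omega)=0$ for all integers $|\omega|>\omega_{\max}$. Then there exist constants $C_p,C_q$, independent of $N$ and $\Delta t$, such that for every even positive integer $N$ and every $\Delta t>0$ the approximate solution operator $S_N(\Delta t)$ of the two-node block Krylov subspace spectral (KSS) method with prescribed nodes, applied to $u_{tt}=(p(x)u_x)_x-q(x)u$ on $(0,2\pi)$ with periodic boundary conditions, satisfies $$\|S_N(\Delta t)\|_{C_N}\le 1+\left(C_p\|\tilde p\|_\infty N+C_q\|\tilde q\|_\infty\right)\Delta t .$$
   Context: Coefficients. $\hat p(\omega)=\frac1{2\pi}\int_0^{2\pi}e^{-i\omega x}p(x)\,dx$, similarly $\hat q(\omega)$. $\overline p,\overline q$ are the averages of $p,q$ over $[0,2\pi]$; $\tilde p=p-\overline p$, $\tilde q=q-\overline q$; $\|\cdot\|_\infty$ of a function is its sup norm. Grid. $N$ is even, $\Delta x=2\pi/N$, grid points $x_j=j\Delta x$, $j=0,\dots,N-1$; wave numbers $\omega\in\hat I_N=\{-N/2+1,\dots,N/2\}$. The discrete Fourier transform is the $N\times N$ matrix $F_N$ with entries $[F_N]_{\omega,j}=\frac1N e^{-i\omega x_j}$ (rows indexed by $\omega\in\hat I_N$). $D_N=F_N^{-1}\,\mathrm{diag}(i\omega)_{\omega\in\hat I_N}F_N$ is the Fourier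 first-derivative matrix. $P_N,Q_N$ are the diagonal matrices of values of $p,q$ at the grid points, and $L_N=-D_NP_ND_N+Q_N$ is the discretization of $Lu=-(p u_x)_x+q u$. KSS operator. Let $f_{11}(\lambda)=f_{22}(\lambda)=\cos(\lambda^{1/2}\Delta t)$, $f_{12}(\lambda)=\lambda^{-1/2}\sin(\lambda^{1/2}\Delta t)$, $f_{21}(\lambda)=-\lambda f_{12}(\lambda)$, with values at $\lambda=0$ defined by continuity. For $\omega\in\hat I_N$ the nodes are $l_{1,\omega}=0$ and $l_{2,\omega}=\overline p\,\omega^2+\overline q$, and $M_{ij,\omega}=\frac{f_{ij}(l_{2,\omega})-f_{ij}(l_{1,\omega})}{l_{2,\omega}-l_{1,\omega}}$. For $i,j\in\{1,2\}$, $S_{N,ij}(\Delta t)$ is the $N\times N$ matrix such that for every vector $\mathbf w\in\mathbb C^N$ and every $\omega\in\hat I_N$, $$[F_NS_{N,ij}(\Delta t)\mathbf w]_\omega=f_{ij}(l_{2,\omega})[F_N\mathbf w]_\omega+M_{ij,\omega}\,[F_N(L_N-l_{2,\omega}I)\mathbf w]_\omega .$$ (That is, in the $\omega$-th Fourier coefficient, $f_{ij}(L_N)$ is replaced by the linear interpolant of $f_{ij}$ at the nodes $l_{1,\omega},l_{2,\omega}$.) $S_N(\Delta t)$ is the $2N\times2N$ block matrix with blocks $S_{N,ij}(\Delta t)$; one time step of the method maps $(\mathbf u^n,\mathbf u^n_t)$ to $S_N(\Delta t)(\mathbf u^n,\mathbf u_t^n)$. Norm. $C_N=F_N^{-1}\,\mathrm{diag}(\overline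 p\,\omega^2+\overline q)_{\omega\in\hat I_N}F_N$, the discretization of $C=-\overline p\,\partial_{xx}+\overline q I$. The $C_N$-norm is $\|(\mathbf u,\mathbf v)\|_{C_N}^2=\mathbf u^HC_N\mathbf u+\|\mathbf v\|_2^2$, and $\|S_N(\Delta t)\|_{C_N}$ is the induced operator norm. *)

theory Defs
  imports
    "HOL-Analysis.Analysis"
    "Jordan_Normal_Form.Gauss_Jordan_Elimination"
    "Jordan_Normal_Form.Determinant"
begin

unbundle no vec_syntax

section \<open>Coefficient functions\<close>

definition fourier_coeff :: "(real \<Rightarrow> real) \<Rightarrow> int \<Rightarrow> complex" where
  "fourier_coeff f \<omega> =
     1 / (2 * of_real pi) *
     integral {0..2 * pi} (\<lambda>x. exp (- \<i> * of_int \<omega> * of_real x) * of_real (f x))"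

definition average :: "(real \<Rightarrow> real) \<Rightarrow> real" where
  "average f = 1 / (2 * pi) * integral {0..2 * pi} f"

definition fluctuation :: "(real \<Rightarrow> real) \<Rightarrow> real \<Rightarrow> real" where
  "fluctuation f x = f x - average f"

text \<open>Meaningful for bounded \<open>f\<close> only: the supremum is taken in the reals.\<close>

definition sup_norm :: "(real \<Rightarrow> real) \<Rightarrow> real" where
  "sup_norm f = (SUP x. \<bar>f x\<bar>)"


section \<open>Grid, discrete Fourier transform and discretized operators\<close>

definition grid_point :: "nat \<Rightarrow> nat \<Rightarrow> real" where
  "grid_point N j = real j * (2 * pi / real N)"

text \<open>
  Matrix rows are indexed by \<open>k < N\<close>; for even \<open>N\<close>, row \<open>k\<close> carries the wave number
  \<open>\<omega> = k - N/2 + 1\<close>, which runs through \<open>{-N/2+1, \<dots>, N/2}\<close> in increasing order.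
\<close>

definition wave_number :: "nat \<Rightarrow> nat \<Rightarrow> int" where
  "wave_number N k = int k - int N div 2 + 1"

definition dft_mat :: "nat \<Rightarrow> complex mat" where
  "dft_mat N = Matrix.mat N N
     (\<lambda>(k, j). 1 / of_nat N * exp (- \<i> * of_int (wave_number N k) * of_real (grid_point N j)))"

text \<open>\<^const>\<open>mat_inverse\<close> is option-valued; invertibility of the DFT matrix is proved below.\<close>

definition idft_mat :: "nat \<Rightarrow> complex mat" where
  "idft_mat N = the (mat_inverse (dft_mat N))"

definition fourier_diff_mat :: "nat \<Rightarrow> complex mat" where
  "fourier_diff_mat N =
     idft_mat N * mat_diag N (\<lambda>k. \<i> * of_int (wave_number N k)) * dft_mat N"

definition grid_diag :: "nat \<Rightarrow> (real \<Rightarrow> real) \<Rightarrow> complex mat" where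
  "grid_diag N f = mat_diag N (\<lambda>j. of_real (f (grid_point N j)))"

definition L_mat :: "(real \<Rightarrow> real) \<Rightarrow> (real \<Rightarrow> real) \<Rightarrow> nat \<Rightarrow> complex mat" where
  "L_mat p q N =
     - (fourier_diff_mat N * grid_diag N p * fourier_diff_mat N) + grid_diag N q"


section \<open>The two-node block KSS operator\<close>

text \<open>
  The functions \<open>f\<^sub>i\<^sub>j\<close> for \<open>i, j \<in> {1, 2}\<close>. The value of \<open>f\<^sub>1\<^sub>2\<close> at \<open>0\<close> is its limit
  from the right; for \<open>f\<^sub>2\<^sub>1\<close> the factor \<open>\<lambda>\<close> gives the right value \<open>0\<close>.
\<close>

definition f_diag :: "real \<Rightarrow> real \<Rightarrow> real" where
  "f_diag dt l = cos (sqrt l * dt)"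

definition f_12 :: "real \<Rightarrow> real \<Rightarrow> real" where
  "f_12 dt l = (if l = 0 then dt else sin (sqrt l * dt) / sqrt l)"

definition kss_fun :: "nat \<Rightarrow> nat \<Rightarrow> real \<Rightarrow> real \<Rightarrow> real" where
  "kss_fun i j dt l =
     (if i = j then f_diag dt l else if i < j then f_12 dt l else - l * f_12 dt l)"

definition node1 :: real where
  "node1 = 0"

definition node2 :: "(real \<Rightarrow> real) \<Rightarrow> (real \<Rightarrow> real) \<Rightarrow> int \<Rightarrow> real" where
  "node2 p q \<omega> = average p * (of_int \<omega>)\<^sup>2 + average q"

definition kss_slope ::
    "(real \<Rightarrow> real) \<Rightarrow> (real \<Rightarrow> real) \<Rightarrow> real \<Rightarrow> nat \<Rightarrow> nat \<Rightarrow> int \<Rightarrow> real" where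
  "kss_slope p q dt i j \<omega> =
     (kss_fun i j dt (node2 p q \<omega>) - kss_fun i j dt node1) / (node2 p q \<omega> - node1)"

definition is_kss_block ::
    "(real \<Rightarrow> real) \<Rightarrow> (real \<Rightarrow> real) \<Rightarrow> nat \<Rightarrow> real \<Rightarrow> nat \<Rightarrow> nat \<Rightarrow> complex mat \<Rightarrow> bool" where
  "is_kss_block p q N dt i j S \<longleftrightarrow>
     S \<in> carrier_mat N N \<and>
     (\<forall>w \<in> carrier_vec N. \<forall>k < N.
        let \<omega> = wave_number N k; l\<^sub>2 = node2 p q \<omega> in
        (dft_mat N *\<^sub>v (S *\<^sub>v w)) $ k =
          of_real (kss_fun i j dt l\<^sub>2) * (dft_mat N *\<^sub>v w) $ k
          + of_real (kss_slope p q dt i j \<omega>)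
            * (dft_mat N *\<^sub>v ((L_mat p q N - of_real l\<^sub>2 \<cdot>\<^sub>m 1\<^sub>m N) *\<^sub>v w)) $ k)"

definition kss_block ::
    "(real \<Rightarrow> real) \<Rightarrow> (real \<Rightarrow> real) \<Rightarrow> nat \<Rightarrow> real \<Rightarrow> nat \<Rightarrow> nat \<Rightarrow> complex mat" where
  "kss_block p q N dt i j = (THE S. is_kss_block p q N dt i j S)"

definition kss_mat :: "(real \<Rightarrow> real) \<Rightarrow> (real \<Rightarrow> real) \<Rightarrow> nat \<Rightarrow> real \<Rightarrow> complex mat" where
  "kss_mat p q N dt =
     four_block_mat (kss_block p q N dt 1 1) (kss_block p q N dt 1 2)
                    (kss_block p q N dt 2 1) (kss_block p q N dt 2 2)"


section \<open>The energy norm and its operator norm\<close>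

definition C_mat :: "(real \<Rightarrow> real) \<Rightarrow> (real \<Rightarrow> real) \<Rightarrow> nat \<Rightarrow> complex mat" where
  "C_mat p q N =
     idft_mat N
     * mat_diag N (\<lambda>k. of_real (average p * (of_int (wave_number N k))\<^sup>2 + average q))
     * dft_mat N"

text \<open>
  A pair \<open>(u, v)\<close> of vectors of length \<open>N\<close> is the vector of length \<open>2N\<close> obtained by appending
  \<open>v\<close> to \<open>u\<close>. The quadratic form is real because \<^const>\<open>C_mat\<close> is Hermitian.
\<close>

definition C_norm :: "(real \<Rightarrow> real) \<Rightarrow> (real \<Rightarrow> real) \<Rightarrow> nat \<Rightarrow> complex vec \<Rightarrow> real" where
  "C_norm p q N w =
     (let u = vec_first w N; v = vec_last w N
      in sqrt (Re ((C_mat p q N *\<^sub>v u) \<bullet>c u) + (\<Sum>j<N. (cmod (v $ j))\<^sup>2)))"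

definition C_op_norm :: "(real \<Rightarrow> real) \<Rightarrow> (real \<Rightarrow> real) \<Rightarrow> nat \<Rightarrow> complex mat \<Rightarrow> real" where
  "C_op_norm p q N A =
     (SUP w \<in> carrier_vec (2 * N) - {0\<^sub>v (2 * N)}. C_norm p q N (A *\<^sub>v w) / C_norm p q N w)"


section \<open>Well-definedness\<close>

lemma exp_root_unity_sum:
  fixes d :: int
  assumes "N > 0" "\<not> int N dvd d"
  shows "(\<Sum>j<N. exp (\<i> * of_int d * of_real (grid_point N j))) = 0"
proof -
  define z where "z = exp (\<i> * of_int d * of_real (2 * pi / real N))"
  have zj: "exp (\<i> * of_int d * of_real (grid_point N j)) = z ^ j" for j
    unfolding z_def grid_point_def exp_of_nat_mult[symmetric] by (simp add: algebra_simps)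
  have zN: "z ^ N = 1"
  proof -
    have "z ^ N = exp (of_int d * (2 * of_real pi * \<i>))"
      unfolding z_def exp_of_nat_mult[symmetric] using assms(1) by (simp add: field_simps)
    then show ?thesis by (simp add: exp_eq_1)
  qed
  have "z \<noteq> 1"
  proof
    assume "z = 1"
    then obtain n :: int where "of_int d * (2 * pi / real N) = of_int (2 * n) * pi"
      unfolding z_def exp_eq_1 by auto
    then have "real_of_int d = of_int (n * int N)"
      using assms(1) by (simp add: field_simps)
    then have "d = n * int N" by linarith
    then show False using assms(2) by simp
  qed
  then show ?thesis unfolding zj by (simp add: geometric_sum zN)
qed

lemma dft_mat_carrier [simp]: "dft_mat N \<in> carrier_mat N N"
  by (simp add: dft_mat_def)

lemma dft_mat_right_inverse:
  assumes "N > 0"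
  shows "dft_mat N * Matrix.mat N N
    (\<lambda>(j, k). exp (\<i> * of_int (wave_number N k) * of_real (grid_point N j))) = 1\<^sub>m N"
proof (rule eq_matI)
  fix k l assume "k < dim_row (1\<^sub>m N :: complex mat)" "l < dim_col (1\<^sub>m N :: complex mat)"
  then have kl: "k < N" "l < N" by auto
  have "(dft_mat N * Matrix.mat N N
      (\<lambda>(j, k). exp (\<i> * of_int (wave_number N k) * of_real (grid_point N j)))) $$ (k, l)
    = (\<Sum>j<N. 1 / of_nat N * exp (- \<i> * of_int (wave_number N k) * of_real (grid_point N j))
         * exp (\<i> * of_int (wave_number N l) * of_real (grid_point N j)))"
    using kl by (simp add: dft_mat_def scalar_prod_def atLeast0LessThan)
  also have "\<dots> = 1 / of_nat N *
      (\<Sum>j<N. exp (\<i> * of_int (int l - int k) * of_real (grid_point N j)))"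
    unfolding sum_distrib_left mult.assoc exp_add[symmetric]
    by (intro sum.cong refl arg_cong2[of _ _ _ _ "(*)"] arg_cong[of _ _ exp])
      (simp add: wave_number_def algebra_simps)
  also have "\<dots> = 1\<^sub>m N $$ (k, l)"
  proof (cases "k = l")
    case True
    then show ?thesis using assms kl by simp
  next
    case False
    have "\<not> int N dvd (int l - int k)"
    proof
      assume "int N dvd (int l - int k)"
      then have "\<bar>int N\<bar> \<le> \<bar>int l - int k\<bar>" using False by (intro dvd_imp_le_int) auto
      then show False using kl by auto
    qed
    from exp_root_unity_sum[OF assms this] False kl show ?thesis by simp
  qed
  finally show "(dft_mat N * Matrix.mat N N
      (\<lambda>(j, k). exp (\<i> * of_int (wave_number N k) * of_real (grid_point N j)))) $$ (k, l)
    = 1\<^sub>m N $$ (k, l)" .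
qed (auto simp: dft_mat_def)

lemma idft_mat:
  assumes "N > 0"
  shows "idft_mat N =
      Matrix.mat N N (\<lambda>(j, k). exp (\<i> * of_int (wave_number N k) * of_real (grid_point N j)))"
    and "dft_mat N * idft_mat N = 1\<^sub>m N" "idft_mat N * dft_mat N = 1\<^sub>m N"
    and "idft_mat N \<in> carrier_mat N N"
proof -
  define G where "G = Matrix.mat N N
    (\<lambda>(j, k). exp (\<i> * of_int (wave_number N k) * of_real (grid_point N j)))"
  have G: "G \<in> carrier_mat N N" by (simp add: G_def)
  have FG: "dft_mat N * G = 1\<^sub>m N"
    unfolding G_def by (rule dft_mat_right_inverse[OF assms])
  have GF: "G * dft_mat N = 1\<^sub>m N"
    by (rule mat_mult_left_right_inverse[OF dft_mat_carrier G FG])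
  have "dft_mat N \<in> Units (ring_mat TYPE(complex) N ())"
    unfolding Units_def using FG GF G by (auto simp: ring_mat_def)
  then obtain B where B: "mat_inverse (dft_mat N) = Some B"
    using mat_inverse(1)[OF dft_mat_carrier, of N "()"] by (cases "mat_inverse (dft_mat N)") auto
  from mat_inverse(2)[OF dft_mat_carrier B]
  have BF: "B * dft_mat N = 1\<^sub>m N" and FB: "dft_mat N * B = 1\<^sub>m N" and Bc: "B \<in> carrier_mat N N"
    by auto
  have "B = B * (dft_mat N * G)" using FG Bc by simp
  also have "\<dots> = B * dft_mat N * G" using assoc_mult_mat[OF Bc dft_mat_carrier G] by simp
  also have "\<dots> = G" using BF G by simp
  finally have "B = G" .
  then have I: "idft_mat N = G" by (simp add: idft_mat_def B)
  show "idft_mat N =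
      Matrix.mat N N (\<lambda>(j, k). exp (\<i> * of_int (wave_number N k) * of_real (grid_point N j)))"
    unfolding I G_def ..
  show "dft_mat N * idft_mat N = 1\<^sub>m N" "idft_mat N * dft_mat N = 1\<^sub>m N"
    "idft_mat N \<in> carrier_mat N N"
    using FG GF G I by auto
qed

lemma L_mat_carrier:
  assumes "N > 0"
  shows "L_mat p q N \<in> carrier_mat N N"
proof -
  have "fourier_diff_mat N \<in> carrier_mat N N"
    unfolding fourier_diff_mat_def
    by (intro mult_carrier_mat[of _ N N] idft_mat(4)[OF assms] mat_diag_dim dft_mat_carrier)
  then show ?thesis unfolding L_mat_def grid_diag_def
    by (intro add_carrier_mat uminus_carrier_mat mult_carrier_mat[of _ N N]) auto
qed

lemma mat_mult_unit_vec:
  fixes A :: "complex mat"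
  assumes "A \<in> carrier_mat n n" "m < n"
  shows "A *\<^sub>v unit_vec n m = col A m"
  using assms by (intro eq_vecI) auto

lemma ex1_kss_block:
  assumes N: "N > 0"
  shows "\<exists>!S. is_kss_block p q N dt i j S"
proof -
  let ?F = "dft_mat N"
  let ?l = "\<lambda>k. node2 p q (wave_number N k)"
  let ?M = "\<lambda>k. kss_slope p q dt i j (wave_number N k)"
  let ?A = "\<lambda>k. L_mat p q N - complex_of_real (?l k) \<cdot>\<^sub>m 1\<^sub>m N"
  define G where "G = Matrix.mat N N (\<lambda>(k, m).
     of_real (kss_fun i j dt (?l k)) * ?F $$ (k, m) + of_real (?M k) * (?F * ?A k) $$ (k, m))"
  have G: "G \<in> carrier_mat N N" by (simp add: G_def)
  have A: "?A k \<in> carrier_mat N N" for k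
    using L_mat_carrier[OF N] by auto
  have Gv: "(G *\<^sub>v w) $ k = of_real (kss_fun i j dt (?l k)) * (?F *\<^sub>v w) $ k
      + of_real (?M k) * (?F *\<^sub>v (?A k *\<^sub>v w)) $ k"
    if w: "w \<in> carrier_vec N" and k: "k < N" for w k
  proof -
    have "(?F *\<^sub>v (?A k *\<^sub>v w)) = (?F * ?A k) *\<^sub>v w"
      using assoc_mult_mat_vec[OF dft_mat_carrier A w] by simp
    moreover have "dim_row ?F = N" "dim_col ?F = N" "dim_col (?A k) = N"
      using carrier_matD[OF dft_mat_carrier[of N]] carrier_matD[OF A[of k]] by blast+
    moreover have "dim_vec w = N" using w by auto
    ultimately show ?thesis using k unfolding G_def
      by (simp add: scalar_prod_def sum.distrib sum_distrib_left algebra_simps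
          del: index_mult_mat(1))
  qed
  have iff: "is_kss_block p q N dt i j S \<longleftrightarrow> S \<in> carrier_mat N N \<and> ?F * S = G" for S
  proof (cases "S \<in> carrier_mat N N")
    case S: True
    have FS: "?F * S \<in> carrier_mat N N" using S by (intro mult_carrier_mat[of _ N N]) auto
    have "is_kss_block p q N dt i j S \<longleftrightarrow>
        (\<forall>w \<in> carrier_vec N. \<forall>k < N. ((?F * S) *\<^sub>v w) $ k = (G *\<^sub>v w) $ k)"
      unfolding is_kss_block_def Let_def
      using S assoc_mult_mat_vec[OF dft_mat_carrier S] Gv by simp
    also have "\<dots> \<longleftrightarrow> (\<forall>w \<in> carrier_vec N. (?F * S) *\<^sub>v w = G *\<^sub>v w)"
      using FS G by (auto simp del: index_mult_mat_vec intro!: eq_vecI)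
    also have "\<dots> \<longleftrightarrow> ?F * S = G"
    proof
      assume *: "\<forall>w \<in> carrier_vec N. (?F * S) *\<^sub>v w = G *\<^sub>v w"
      show "?F * S = G"
      proof (rule mat_col_eqI)
        fix m assume "m < dim_col G"
        then have m: "m < N" using G by simp
        have "col (?F * S) m = (?F * S) *\<^sub>v unit_vec N m"
          using mat_mult_unit_vec[OF FS m] by simp
        also have "\<dots> = G *\<^sub>v unit_vec N m" using * by simp
        also have "\<dots> = col G m" using mat_mult_unit_vec[OF G m] by simp
        finally show "col (?F * S) m = col G m" .
      qed (use FS G in auto)
    qed simp
    finally show ?thesis using S by simp
  qed (simp add: is_kss_block_def)
  note inv = idft_mat(2-4)[OF N]
  show ?thesis
  proof (rule ex1I[of _ "idft_mat N * G"])
    have "?F * (idft_mat N * G) = G"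
      using assoc_mult_mat[OF dft_mat_carrier inv(3) G] inv G by simp
    then show "is_kss_block p q N dt i j (idft_mat N * G)"
      using iff inv(3) G by auto
  next
    fix S assume "is_kss_block p q N dt i j S"
    then have S: "S \<in> carrier_mat N N" and FS: "?F * S = G" using iff by auto
    have "idft_mat N * G = idft_mat N * ?F * S"
      using assoc_mult_mat[OF inv(3) dft_mat_carrier S] FS by simp
    then show "S = idft_mat N * G" using inv S by simp
  qed
qed

lemma is_kss_block_kss_block: "N > 0 \<Longrightarrow> is_kss_block p q N dt i j (kss_block p q N dt i j)"
  unfolding kss_block_def by (rule theI'[OF ex1_kss_block])

end

theory Submission
  imports Defs
begin

text \<open>
  By the discrete Parseval identity, the \<open>C\<^sub>N\<close>-norm is a Euclidean norm of the Fourier modes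
  \<open>z\<^sub>\<omega> = (\<surd>l\<^sub>\<omega> u\<^sub>\<omega>, v\<^sub>\<omega>)\<close> with \<open>l\<^sub>\<omega> = l\<^sub>2\<^sub>,\<^sub>\<omega>\<close>. For constant coefficients one time step
  rotates each \<open>z\<^sub>\<omega>\<close> by the angle \<open>\<surd>l\<^sub>\<omega> \<Delta>t\<close>, hence is an isometry. The remainder applies
  the slopes \<open>M\<^sub>i\<^sub>j\<close> to the Fourier modes of \<open>L\<^sub>N - C\<^sub>N = -D\<^sub>N P' D\<^sub>N + Q'\<close>, where \<open>P'\<close> and \<open>Q'\<close>
  are the diagonal matrices of the fluctuations. Weighted by \<open>\<surd>l\<^sub>\<omega>\<close> as in the norm, each slope gains a
  factor \<open>\<Delta>t\<close>, and when it acts on \<open>v\<close> also a factor \<open>1/\<surd>l\<^sub>\<omega>\<close>. Together with \<open>\<surd>l\<^sub>\<omega>\<close> in the norm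
  of \<open>u\<close> this absorbs one of the two derivatives, since \<open>|\<omega>| \<le> \<surd>l\<^sub>\<omega> / \<surd>avg p\<close>; the other one costs
  at most \<open>N/2\<close>. Only the sup norms of the fluctuations enter.
\<close>

section \<open>Discrete Parseval identity and multiplication by grid functions\<close>

abbreviation vec_L2 :: "nat \<Rightarrow> complex vec \<Rightarrow> real" where
  "vec_L2 N x \<equiv> L2_set (\<lambda>j. cmod (x $ j)) {..<N}"

lemma dft_vec_carrier [simp]: "x \<in> carrier_vec N \<Longrightarrow> dft_mat N *\<^sub>v x \<in> carrier_vec N"
  by (rule mult_mat_vec_carrier[OF dft_mat_carrier])

lemma mult_mat_vec_index:
  assumes "A \<in> carrier_mat n m" "y \<in> carrier_vec m" "j < n"
  shows "(A *\<^sub>v y) $ j = (\<Sum>k<m. A $$ (j, k) * y $ k)"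
  using assms by (auto simp: scalar_prod_def atLeast0LessThan)

text \<open>With the normalization 1/N of \<open>dft_mat\<close>, the inverse matrix is N times the
  conjugate transpose. Writing x as \<open>idft_mat N\<close> applied to its own Fourier
  coefficients and exchanging the two sums then moves the transform onto y.\<close>

lemma dft_inner_prod:
  assumes N: "N > 0" and x: "x \<in> carrier_vec N" and y: "y \<in> carrier_vec N"
  shows "x \<bullet>c y = of_nat N * (\<Sum>k<N. (dft_mat N *\<^sub>v x) $ k * cnj ((dft_mat N *\<^sub>v y) $ k))"
proof -
  let ?F = "dft_mat N" and ?G = "idft_mat N"
  note inv = idft_mat[OF N]
  have Fx: "?F *\<^sub>v x \<in> carrier_vec N" using x by (rule dft_vec_carrier)
  have cnjF: "of_nat N * cnj ((?F *\<^sub>v y) $ k) = (\<Sum>j<N. ?G $$ (j, k) * cnj (y $ j))"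
    if "k < N" for k
    unfolding inv(1) using that N y
    by (simp add: dft_mat_def scalar_prod_def atLeast0LessThan sum_distrib_left exp_cnj)
  have "of_nat N * (\<Sum>k<N. (?F *\<^sub>v x) $ k * cnj ((?F *\<^sub>v y) $ k))
      = (\<Sum>k<N. \<Sum>j<N. ?G $$ (j, k) * (?F *\<^sub>v x) $ k * cnj (y $ j))"
    unfolding sum_distrib_left
  proof (rule sum.cong[OF refl], goal_cases)
    case (1 k)
    then have "of_nat N * ((?F *\<^sub>v x) $ k * cnj ((?F *\<^sub>v y) $ k))
        = (?F *\<^sub>v x) $ k * (\<Sum>j<N. ?G $$ (j, k) * cnj (y $ j))"
      using cnjF[of k] by (simp only: lessThan_iff flip: mult.left_commute[of "(?F *\<^sub>v x) $ k"])
    then show ?case by (simp add: sum_distrib_left mult_ac)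
  qed
  also have "\<dots> = (\<Sum>j<N. (\<Sum>k<N. ?G $$ (j, k) * (?F *\<^sub>v x) $ k) * cnj (y $ j))"
    unfolding sum_distrib_right by (rule sum.swap)
  also have "\<dots> = (\<Sum>j<N. (?G *\<^sub>v (?F *\<^sub>v x)) $ j * cnj (y $ j))"
  proof (rule sum.cong[OF refl], goal_cases)
    case (1 j)
    have "(?G *\<^sub>v (?F *\<^sub>v x)) $ j = (\<Sum>k<N. ?G $$ (j, k) * (?F *\<^sub>v x) $ k)"
      using 1 by (intro mult_mat_vec_index[OF inv(4) Fx]) simp
    then show ?case by simp
  qed
  also have "?G *\<^sub>v (?F *\<^sub>v x) = x"
    using assoc_mult_mat_vec[OF inv(4) dft_mat_carrier x] inv(3) x by simp
  also have "(\<Sum>j<N. x $ j * cnj (y $ j)) = x \<bullet>c y"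
    using x y by (simp add: scalar_prod_def atLeast0LessThan)
  finally show ?thesis ..
qed

lemma dft_Parseval:
  assumes N: "N > 0" and x: "x \<in> carrier_vec N"
  shows "(\<Sum>j<N. (cmod (x $ j))\<^sup>2) = real N * (\<Sum>k<N. (cmod ((dft_mat N *\<^sub>v x) $ k))\<^sup>2)"
proof -
  have "x \<bullet>c x = of_real (\<Sum>j<N. (cmod (x $ j))\<^sup>2)"
    using x by (simp add: scalar_prod_def atLeast0LessThan complex_norm_square del: of_real_power)
  moreover have "\<dots> = complex_of_real (real N * (\<Sum>k<N. (cmod ((dft_mat N *\<^sub>v x) $ k))\<^sup>2))"
    using calculation dft_inner_prod[OF N x x]
    by (simp add: complex_norm_square del: of_real_power index_mult_mat_vec)
  ultimately show ?thesis using of_real_eq_iff by blast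
qed

lemma vec_L2_dft:
  assumes "N > 0" "x \<in> carrier_vec N"
  shows "vec_L2 N x = sqrt (real N) * vec_L2 N (dft_mat N *\<^sub>v x)"
  unfolding L2_set_def dft_Parseval[OF assms] real_sqrt_mult ..

lemma mat_diag_mult_vec_index:
  assumes "x \<in> carrier_vec n" "k < n"
  shows "(mat_diag n f *\<^sub>v x) $ k = f k * x $ k"
proof -
  have "(mat_diag n f *\<^sub>v x) $ k = (\<Sum>j<n. (if j = k then f k * x $ k else 0))"
    unfolding mult_mat_vec_index[OF mat_diag_dim assms]
    using assms(2) by (intro sum.cong) (auto simp: mat_diag_def)
  then show ?thesis using assms(2) by simp
qed

lemma L2_set_leq_mult:
  assumes "\<And>i. i \<in> A \<Longrightarrow> 0 \<le> f i" "\<And>i. i \<in> A \<Longrightarrow> f i \<le> c * g i" "0 \<le> c"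
  shows "L2_set f A \<le> c * L2_set g A"
  unfolding L2_set_right_distrib[OF assms(3)] by (intro L2_set_mono assms)

text \<open>Multiplication by f mixes Fourier modes but is diagonal on the grid. Parseval leads to
  the grid, where the pointwise bound applies, and back; the two factors sqrt(N) cancel. Hence only
  a sup norm enters, with no sum over Fourier coefficients of f.\<close>

lemma vec_L2_dft_grid_diag:
  assumes N: "N > 0" and x: "x \<in> carrier_vec N" and B: "\<And>t. \<bar>f t\<bar> \<le> B"
  shows "vec_L2 N (dft_mat N *\<^sub>v (grid_diag N f *\<^sub>v x)) \<le> B * vec_L2 N (dft_mat N *\<^sub>v x)"
proof -
  have fx: "grid_diag N f *\<^sub>v x \<in> carrier_vec N"
    unfolding grid_diag_def by (rule mult_mat_vec_carrier[OF mat_diag_dim x])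
  have B0: "0 \<le> B" using B[of 0] by linarith
  have "vec_L2 N (grid_diag N f *\<^sub>v x) \<le> B * vec_L2 N x"
  proof (rule L2_set_leq_mult[OF _ _ B0])
    fix j assume "j \<in> {..<N}"
    then have "(grid_diag N f *\<^sub>v x) $ j = of_real (f (grid_point N j)) * x $ j"
      unfolding grid_diag_def by (intro mat_diag_mult_vec_index[OF x]) simp
    then show "cmod ((grid_diag N f *\<^sub>v x) $ j) \<le> B * cmod (x $ j)"
      using mult_right_mono[OF B norm_ge_zero] by (simp only: norm_mult norm_of_real)
  qed simp
  then have "sqrt N * vec_L2 N (dft_mat N *\<^sub>v (grid_diag N f *\<^sub>v x))
      \<le> sqrt N * (B * vec_L2 N (dft_mat N *\<^sub>v x))"
    unfolding vec_L2_dft[OF N fx] vec_L2_dft[OF N x] by (simp only: mult.left_commute)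
  then show ?thesis using N by simp
qed

section \<open>Fourier multipliers and the splitting of the discretized operator\<close>

lemma fourier_diff_mat_carrier:
  assumes "N > 0"
  shows "fourier_diff_mat N \<in> carrier_mat N N"
  unfolding fourier_diff_mat_def
  by (intro mult_carrier_mat[of _ N N] idft_mat(4)[OF assms] mat_diag_dim dft_mat_carrier)

text \<open>The transform cancels against its inverse. Both \<open>fourier_diff_mat\<close> and
  \<open>C_mat\<close> have this form, so both act diagonally on Fourier coefficients.\<close>

lemma dft_multiplier:
  assumes N: "N > 0" and x: "x \<in> carrier_vec N" and k: "k < N"
  shows "(dft_mat N *\<^sub>v ((idft_mat N * mat_diag N g * dft_mat N) *\<^sub>v x)) $ k
    = g k * (dft_mat N *\<^sub>v x) $ k"
proof -
  let ?F = "dft_mat N" and ?G = "idft_mat N" and ?D = "mat_diag N g"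
  note inv = idft_mat[OF N]
  have D: "?D \<in> carrier_mat N N" by simp
  have DF: "?D * ?F \<in> carrier_mat N N" by (rule mult_carrier_mat[OF D dft_mat_carrier])
  have G: "?G * ?D * ?F \<in> carrier_mat N N"
    by (rule mult_carrier_mat[OF mult_carrier_mat[OF inv(4) D] dft_mat_carrier])
  have "?F * (?G * ?D * ?F) = ?F * ?G * (?D * ?F)"
    using assoc_mult_mat[OF inv(4) D dft_mat_carrier] assoc_mult_mat[OF dft_mat_carrier inv(4) DF]
    by simp
  also have "\<dots> = ?D * ?F" unfolding inv(2) by (rule left_mult_one_mat[OF DF])
  finally have "?F *\<^sub>v ((?G * ?D * ?F) *\<^sub>v x) = ?D *\<^sub>v (?F *\<^sub>v x)"
    using assoc_mult_mat_vec[OF dft_mat_carrier G x] assoc_mult_mat_vec[OF D dft_mat_carrier x]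
    by simp
  then show ?thesis using mat_diag_mult_vec_index[OF dft_vec_carrier[OF x] k, of g] by simp
qed

lemma dft_fourier_diff_mat:
  assumes "N > 0" "x \<in> carrier_vec N" "k < N"
  shows "(dft_mat N *\<^sub>v (fourier_diff_mat N *\<^sub>v x)) $ k
    = \<i> * of_int (wave_number N k) * (dft_mat N *\<^sub>v x) $ k"
  unfolding fourier_diff_mat_def by (rule dft_multiplier[OF assms])

lemma grid_diag_fluctuation:
  assumes "x \<in> carrier_vec N"
  shows "grid_diag N f *\<^sub>v x
    = of_real (average f) \<cdot>\<^sub>v x + grid_diag N (fluctuation f) *\<^sub>v x"
proof (rule eq_vecI)
  fix j assume "j < dim_vec (of_real (average f) \<cdot>\<^sub>v x + grid_diag N (fluctuation f) *\<^sub>v x)"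
  then have j: "j < N" by (simp add: grid_diag_def mat_diag_def)
  have gj: "(grid_diag N g *\<^sub>v x) $ j = of_real (g (grid_point N j)) * x $ j" for g
    unfolding grid_diag_def by (rule mat_diag_mult_vec_index[OF assms j])
  have "j < dim_vec (grid_diag N (fluctuation f) *\<^sub>v x)" "j < dim_vec x"
    using j assms by (auto simp: grid_diag_def mat_diag_def)
  then show "(grid_diag N f *\<^sub>v x) $ j
      = (of_real (average f) \<cdot>\<^sub>v x + grid_diag N (fluctuation f) *\<^sub>v x) $ j"
    by (simp add: gj fluctuation_def algebra_simps del: index_mult_mat_vec)
qed (use assms in \<open>simp_all add: grid_diag_def mat_diag_def\<close>)

lemma grid_diag_carrier [simp]: "grid_diag N f \<in> carrier_mat N N"
  by (simp add: grid_diag_def)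

text \<open>The Fourier coefficients of \<open>(L\<^sub>N - C\<^sub>N) x\<close>.\<close>

definition dft_residual ::
    "(real \<Rightarrow> real) \<Rightarrow> (real \<Rightarrow> real) \<Rightarrow> nat \<Rightarrow> complex vec \<Rightarrow> nat \<Rightarrow> complex" where
  "dft_residual p q N x k =
     (dft_mat N *\<^sub>v (grid_diag N (fluctuation q) *\<^sub>v x)) $ k
     - \<i> * of_int (wave_number N k) *
       (dft_mat N *\<^sub>v (grid_diag N (fluctuation p) *\<^sub>v (fourier_diff_mat N *\<^sub>v x))) $ k"

text \<open>Split p and q into average and fluctuation. The average of p passes through both
  derivatives and picks up -(i omega)^2 = omega^2; with the average of q it forms
  \<open>node2\<close>, the eigenvalue of \<open>C_mat\<close>. The fluctuations make up the
  residual.\<close>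

lemma dft_L_mat:
  assumes N: "N > 0" and x: "x \<in> carrier_vec N" and k: "k < N"
  shows "(dft_mat N *\<^sub>v (L_mat p q N *\<^sub>v x)) $ k
    = of_real (node2 p q (wave_number N k)) * (dft_mat N *\<^sub>v x) $ k + dft_residual p q N x k"
proof -
  let ?F = "dft_mat N" and ?D = "fourier_diff_mat N" and ?P = "grid_diag N p" and ?Q = "grid_diag N q"
  let ?p = "grid_diag N (fluctuation p)" and ?q = "grid_diag N (fluctuation q)"
  let ?w = "\<i> * of_int (wave_number N k) :: complex"
  have D: "?D \<in> carrier_mat N N" by (rule fourier_diff_mat_carrier[OF N])
  have Dx: "?D *\<^sub>v x \<in> carrier_vec N" using D x by (rule mult_mat_vec_carrier)
  have gx: "grid_diag N f *\<^sub>v y \<in> carrier_vec N" if "y \<in> carrier_vec N" for f y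
    using grid_diag_carrier that by (rule mult_mat_vec_carrier)
  have DP: "?D * ?P \<in> carrier_mat N N" using D grid_diag_carrier by (rule mult_carrier_mat)
  have DPD: "?D * ?P * ?D \<in> carrier_mat N N" using DP D by (rule mult_carrier_mat)
  have DPx: "?D *\<^sub>v (?P *\<^sub>v (?D *\<^sub>v x)) \<in> carrier_vec N"
    using D gx[OF Dx] by (rule mult_mat_vec_carrier)
  have neg_add: "- a + b = b - a" if "a \<in> carrier_vec N" "b \<in> carrier_vec N" for a b :: "complex vec"
    using that by (intro eq_vecI) auto
  have "L_mat p q N *\<^sub>v x = - (?D * ?P * ?D) *\<^sub>v x + ?Q *\<^sub>v x"
    unfolding L_mat_def
    by (rule add_mult_distrib_mat_vec[OF uminus_carrier_mat[OF DPD] grid_diag_carrier x])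
  also have "- (?D * ?P * ?D) *\<^sub>v x = - ((?D * ?P * ?D) *\<^sub>v x)"
    by (rule uminus_mult_mat_vec) (use carrier_matD[OF DPD] x in auto)
  also have "(?D * ?P * ?D) *\<^sub>v x = ?D *\<^sub>v (?P *\<^sub>v (?D *\<^sub>v x))"
    using assoc_mult_mat_vec[OF DP D x] assoc_mult_mat_vec[OF D grid_diag_carrier Dx] by simp
  also have "- (?D *\<^sub>v (?P *\<^sub>v (?D *\<^sub>v x))) + ?Q *\<^sub>v x
      = ?Q *\<^sub>v x - ?D *\<^sub>v (?P *\<^sub>v (?D *\<^sub>v x))"
    by (rule neg_add[OF DPx gx[OF x]])
  finally have "?F *\<^sub>v (L_mat p q N *\<^sub>v x)
      = ?F *\<^sub>v (?Q *\<^sub>v x) - ?F *\<^sub>v (?D *\<^sub>v (?P *\<^sub>v (?D *\<^sub>v x)))"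
    using mult_minus_distrib_mat_vec[OF dft_mat_carrier gx[OF x] DPx] by simp
  then have "(?F *\<^sub>v (L_mat p q N *\<^sub>v x)) $ k
      = (?F *\<^sub>v (?Q *\<^sub>v x)) $ k - (?F *\<^sub>v (?D *\<^sub>v (?P *\<^sub>v (?D *\<^sub>v x)))) $ k"
    using k carrier_matD(1)[OF dft_mat_carrier[of N]] by (simp del: index_mult_mat_vec)
  moreover have "(?F *\<^sub>v (?D *\<^sub>v (?P *\<^sub>v (?D *\<^sub>v x)))) $ k = ?w * (?F *\<^sub>v (?P *\<^sub>v (?D *\<^sub>v x))) $ k"
    by (rule dft_fourier_diff_mat[OF N gx[OF Dx] k])
  moreover have split: "(?F *\<^sub>v (grid_diag N f *\<^sub>v y)) $ k = of_real (average f) * (?F *\<^sub>v y) $ k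
      + (?F *\<^sub>v (grid_diag N (fluctuation f) *\<^sub>v y)) $ k" if y: "y \<in> carrier_vec N" for f y
    unfolding grid_diag_fluctuation[OF y, of f]
      mult_add_distrib_mat_vec[OF dft_mat_carrier smult_carrier_vec[THEN iffD2, OF y] gx[OF y]]
      mult_mat_vec[OF dft_mat_carrier y]
    using k carrier_matD(1)[OF dft_mat_carrier[of N]] by (simp del: index_mult_mat_vec)
  moreover have "(?F *\<^sub>v (?D *\<^sub>v x)) $ k = ?w * (?F *\<^sub>v x) $ k"
    by (rule dft_fourier_diff_mat[OF N x k])
  ultimately show ?thesis
    using split[OF x, of q] split[OF Dx, of p]
    by (simp add: dft_residual_def node2_def algebra_simps power2_eq_square del: index_mult_mat_vec)
qed

text \<open>Evenness matters: for odd N the largest wave number is (N+1)/2.\<close>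

lemma wave_number_bound:
  assumes "even N" "k < N"
  shows "\<bar>real_of_int (wave_number N k)\<bar> \<le> real N / 2"
proof -
  obtain m where "N = 2 * m" using assms(1) by auto
  then have "\<bar>wave_number N k\<bar> \<le> int m" using assms(2) by (auto simp: wave_number_def)
  then have "real_of_int \<bar>wave_number N k\<bar> \<le> real m" by linarith
  then show ?thesis using \<open>N = 2 * m\<close> by simp
qed

section \<open>Interpolation slopes and the KSS blocks in Fourier coordinates\<close>

text \<open>With s the square root of the second node, these are the slopes as they enter the two
  components of an energy mode: those feeding the first component carry an extra factor s. All
  bounds are linear in dt. The slopes applied to u need a bound free of s; those applied to v retain
  1/s.\<close>

lemma slope_bounds:
  fixes s dt :: real
  assumes s: "s > 0" and dt: "dt > 0"
  shows "\<bar>s * ((cos (s * dt) - 1) / s\<^sup>2)\<bar> \<le> dt"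
    and "\<bar>(cos (s * dt) - 1) / s\<^sup>2\<bar> \<le> dt / s"
    and "\<bar>s * ((sin (s * dt) / s - dt) / s\<^sup>2)\<bar> \<le> 2 * dt / s"
    and "\<bar>sin (s * dt) / s\<bar> \<le> dt"
proof -
  have "cos (s * dt) - 1 = - (2 * (sin (s * dt / 2))\<^sup>2)"
    using cos_double_sin[of "s * dt / 2"] by simp
  then have "\<bar>cos (s * dt) - 1\<bar> = 2 * (\<bar>sin (s * dt / 2)\<bar> * \<bar>sin (s * dt / 2)\<bar>)"
    by (simp add: power2_eq_square abs_mult)
  \<comment> \<open>One sine is bounded by its argument and the other by 1. Bounding both by the
    argument would give (s dt)^2 / 2, which is not O(s dt) uniformly in s.\<close>
  also have "\<dots> \<le> 2 * (\<bar>s * dt / 2\<bar> * 1)"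
    by (intro mult_left_mono mult_mono abs_sin_x_le_abs_x) auto
  finally have c: "\<bar>cos (s * dt) - 1\<bar> \<le> s * dt" using s dt by simp
  have si: "\<bar>sin (s * dt)\<bar> \<le> s * dt"
    using abs_sin_x_le_abs_x[of "s * dt"] s dt by simp
  have c': "\<bar>cos (s * dt) - 1\<bar> / s \<le> dt" using c s by (simp add: pos_divide_le_eq mult.commute)
  have "\<bar>s * ((cos (s * dt) - 1) / s\<^sup>2)\<bar> = \<bar>cos (s * dt) - 1\<bar> / s"
    using s by (simp add: abs_mult power2_eq_square)
  then show "\<bar>s * ((cos (s * dt) - 1) / s\<^sup>2)\<bar> \<le> dt" using c' by simp
  have "\<bar>(cos (s * dt) - 1) / s\<^sup>2\<bar> = \<bar>cos (s * dt) - 1\<bar> / s / s"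
    using s unfolding power2_eq_square abs_divide abs_mult by simp
  also have "\<dots> \<le> dt / s"
    using c' s by (intro divide_right_mono) simp_all
  finally show "\<bar>(cos (s * dt) - 1) / s\<^sup>2\<bar> \<le> dt / s" .
  show 4: "\<bar>sin (s * dt) / s\<bar> \<le> dt" using si s by (simp add: pos_divide_le_eq mult.commute)
  have "\<bar>s * ((sin (s * dt) / s - dt) / s\<^sup>2)\<bar> = \<bar>sin (s * dt) / s - dt\<bar> / s"
    using s by (simp add: abs_mult power2_eq_square)
  also have "\<dots> \<le> 2 * dt / s"
    using 4 s dt by (intro divide_right_mono) linarith+
  finally show "\<bar>s * ((sin (s * dt) / s - dt) / s\<^sup>2)\<bar> \<le> 2 * dt / s" .
qed

text \<open>Subtracting the node removes exactly the diagonal part found in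
  \<open>dft_L_mat\<close>, so the slope multiplies the residual alone. All coupling between
  different modes sits in that term.\<close>

lemma dft_kss_block:
  assumes N: "N > 0" and x: "x \<in> carrier_vec N" and k: "k < N"
  shows "(dft_mat N *\<^sub>v (kss_block p q N dt i j *\<^sub>v x)) $ k
    = of_real (kss_fun i j dt (node2 p q (wave_number N k))) * (dft_mat N *\<^sub>v x) $ k
      + of_real (kss_slope p q dt i j (wave_number N k)) * dft_residual p q N x k"
proof -
  let ?F = "dft_mat N" and ?L = "L_mat p q N" and ?l = "node2 p q (wave_number N k)"
  have L: "?L \<in> carrier_mat N N" by (rule L_mat_carrier[OF N])
  have Lx: "?L *\<^sub>v x \<in> carrier_vec N" by (rule mult_mat_vec_carrier[OF L x])
  have lx: "of_real ?l \<cdot>\<^sub>v x \<in> carrier_vec N" using x by simp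
  have "(of_real ?l \<cdot>\<^sub>m 1\<^sub>m N) *\<^sub>v x = of_real ?l \<cdot>\<^sub>v x"
    using x by (intro eq_vecI) auto
  then have "(?L - of_real ?l \<cdot>\<^sub>m 1\<^sub>m N) *\<^sub>v x = ?L *\<^sub>v x - of_real ?l \<cdot>\<^sub>v x"
    using minus_mult_distrib_mat_vec[OF L _ x] by simp
  then have "?F *\<^sub>v ((?L - of_real ?l \<cdot>\<^sub>m 1\<^sub>m N) *\<^sub>v x)
      = ?F *\<^sub>v (?L *\<^sub>v x) - of_real ?l \<cdot>\<^sub>v (?F *\<^sub>v x)"
    using mult_minus_distrib_mat_vec[OF dft_mat_carrier Lx lx] mult_mat_vec[OF dft_mat_carrier x]
    by simp
  then have "(?F *\<^sub>v ((?L - of_real ?l \<cdot>\<^sub>m 1\<^sub>m N) *\<^sub>v x)) $ k = dft_residual p q N x k"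
    using dft_L_mat[OF N x k] k carrier_matD(1)[OF dft_mat_carrier[of N]]
    by (simp del: index_mult_mat_vec)
  then show ?thesis
    using is_kss_block_kss_block[OF N, of p q dt i j] x k
    by (simp add: is_kss_block_def Let_def del: index_mult_mat_vec)
qed

lemma kss_block_carrier: "N > 0 \<Longrightarrow> kss_block p q N dt i j \<in> carrier_mat N N"
  using is_kss_block_kss_block by (simp add: is_kss_block_def)

section \<open>The energy norm in terms of Fourier modes\<close>

text \<open>A pair is used so that the product norm on \<open>complex \<times> complex\<close> is
  the Euclidean norm of one mode; the weight turns the quadratic form of \<open>C_mat\<close> into a
  plain sum of squares.\<close>

definition energy_mode ::
    "(real \<Rightarrow> real) \<Rightarrow> (real \<Rightarrow> real) \<Rightarrow> nat \<Rightarrow> complex vec \<Rightarrow> complex vec \<Rightarrow> nat \<Rightarrow> complex \<times> complex"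
  where "energy_mode p q N u v k =
    (of_real (sqrt (node2 p q (wave_number N k))) * (dft_mat N *\<^sub>v u) $ k, (dft_mat N *\<^sub>v v) $ k)"

lemma norm_rotation:
  fixes a b :: complex
  shows "norm (of_real (cos t) * a + of_real (sin t) * b, of_real (cos t) * b - of_real (sin t) * a)
    = norm (a, b)"
proof -
  have "(cmod (of_real c * a + of_real s * b))\<^sup>2 + (cmod (of_real c * b - of_real s * a))\<^sup>2
      = (c\<^sup>2 + s\<^sup>2) * ((cmod a)\<^sup>2 + (cmod b)\<^sup>2)" for c s :: real
    unfolding cmod_power2 by (simp add: algebra_simps power2_eq_square)
  then show ?thesis by (simp add: norm_Pair)
qed

lemma C_norm_append:
  assumes N: "N > 0" and u: "u \<in> carrier_vec N" and v: "v \<in> carrier_vec N"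
    and l: "\<And>k. k < N \<Longrightarrow> 0 \<le> node2 p q (wave_number N k)"
  shows "C_norm p q N (u @\<^sub>v v)
    = sqrt (real N) * L2_set (\<lambda>k. norm (energy_mode p q N u v k)) {..<N}"
proof -
  let ?F = "dft_mat N" and ?l = "\<lambda>k. node2 p q (wave_number N k)"
  have uv: "vec_first (u @\<^sub>v v) N = u" "vec_last (u @\<^sub>v v) N = v"
    using u v by (auto simp: vec_first_def vec_last_def)
  have C: "C_mat p q N \<in> carrier_mat N N" unfolding C_mat_def
    by (intro mult_carrier_mat[of _ N N] idft_mat(4)[OF N] mat_diag_dim dft_mat_carrier)
  have "(C_mat p q N *\<^sub>v u) \<bullet>c u
      = of_nat N * (\<Sum>k<N. (?F *\<^sub>v (C_mat p q N *\<^sub>v u)) $ k * cnj ((?F *\<^sub>v u) $ k))"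
    by (rule dft_inner_prod[OF N mult_mat_vec_carrier[OF C u] u])
  also have "(\<Sum>k<N. (?F *\<^sub>v (C_mat p q N *\<^sub>v u)) $ k * cnj ((?F *\<^sub>v u) $ k))
      = (\<Sum>k<N. of_real (?l k * (cmod ((?F *\<^sub>v u) $ k))\<^sup>2))"
  proof (rule sum.cong[OF refl], goal_cases)
    case (1 k)
    then have "(?F *\<^sub>v (C_mat p q N *\<^sub>v u)) $ k = of_real (?l k) * (?F *\<^sub>v u) $ k"
      unfolding C_mat_def node2_def by (intro dft_multiplier[OF N u]) simp
    then show ?case
      by (simp add: complex_norm_square mult.assoc del: index_mult_mat_vec of_real_power)
  qed
  finally have "Re ((C_mat p q N *\<^sub>v u) \<bullet>c u) = real N * (\<Sum>k<N. ?l k * (cmod ((?F *\<^sub>v u) $ k))\<^sup>2)"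
    by (simp del: index_mult_mat_vec flip: of_real_sum)
  then have "C_norm p q N (u @\<^sub>v v)
      = sqrt (real N * (\<Sum>k<N. ?l k * (cmod ((?F *\<^sub>v u) $ k))\<^sup>2 + (cmod ((?F *\<^sub>v v) $ k))\<^sup>2))"
    unfolding C_norm_def uv Let_def dft_Parseval[OF N v] sum.distrib distrib_left by simp
  also have "(\<Sum>k<N. ?l k * (cmod ((?F *\<^sub>v u) $ k))\<^sup>2 + (cmod ((?F *\<^sub>v v) $ k))\<^sup>2)
      = (\<Sum>k<N. (norm (energy_mode p q N u v k))\<^sup>2)"
    using l by (intro sum.cong refl)
      (simp add: energy_mode_def norm_Pair norm_mult power_mult_distrib del: index_mult_mat_vec)
  finally show ?thesis by (simp add: L2_set_def real_sqrt_mult)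
qed

section \<open>Positivity of the averages and lower bounds for the nodes\<close>

text \<open>No positive lower bound on f is available. A nonnegative function with zero integral
  vanishes almost everywhere, which strict positivity excludes on a set of positive measure.
  Nonnegativity upgrades gauge integrability to Lebesgue integrability for this argument.\<close>

lemma average_pos:
  assumes f: "f integrable_on {0..2 * pi}" and pos: "\<And>x. f x > 0"
  shows "average f > 0"
proof -
  let ?S = "{0..2 * pi}"
  have "f absolutely_integrable_on ?S"
    using f pos by (intro nonnegative_absolutely_integrable_1) (auto intro: less_imp_le)
  then have int: "integrable (lebesgue_on ?S) f"
    by (intro absolutely_integrable_imp_integrable) auto
  have "integral ?S f \<noteq> 0"
  proof
    assume "integral ?S f = 0"
    then have "integral\<^sup>L (lebesgue_on ?S) f = 0"
      using lebesgue_integral_eq_integral[OF int] by simp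
    then have "AE x in lebesgue_on ?S. f x = 0"
      using integral_nonneg_eq_0_iff_AE[OF int] pos by (simp add: less_imp_le)
    then have "AE x in lebesgue_on ?S. False"
      by eventually_elim (use pos less_irrefl in metis)
    then have "emeasure (lebesgue_on ?S) (space (lebesgue_on ?S)) = 0"
      by (subst (asm) AE_iff_measurable[OF sets.top]) auto
    then show False by (simp add: emeasure_restrict_space space_restrict_space)
  qed
  moreover have "integral ?S f \<ge> 0"
    using f pos by (intro integral_nonneg) (auto intro: less_imp_le)
  ultimately show ?thesis by (simp add: average_def)
qed

lemma sqrt_node2_bounds:
  assumes "average p > 0" "average q > 0"
  shows "sqrt (average q) \<le> sqrt (node2 p q \<omega>)"
    and "sqrt (average p) * \<bar>real_of_int \<omega>\<bar> \<le> sqrt (node2 p q \<omega>)"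
    and "0 < sqrt (node2 p q \<omega>)"
proof -
  show 1: "sqrt (average q) \<le> sqrt (node2 p q \<omega>)" using assms by (simp add: node2_def)
  have "sqrt (average p) * \<bar>real_of_int \<omega>\<bar> = sqrt (average p * (real_of_int \<omega>)\<^sup>2)"
    by (simp add: real_sqrt_mult)
  also have "\<dots> \<le> sqrt (node2 p q \<omega>)"
    using assms by (simp add: node2_def)
  finally show "sqrt (average p) * \<bar>real_of_int \<omega>\<bar> \<le> sqrt (node2 p q \<omega>)" .
  show "0 < sqrt (node2 p q \<omega>)" using 1 assms(2) by (meson less_le_trans real_sqrt_gt_zero)
qed

section \<open>Estimates for the residual\<close>

text \<open>The first estimate is for x = u, whose energy carries the weight sqrt(l); the second is
  for x = v, where the slopes supply 1/sqrt(l). The same constant \<open>K\<close> results: one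
  derivative is absorbed at the price 1/sqrt(average p), the other costs N/2, and the term with q
  uses sqrt(l) >= sqrt(average q).\<close>

lemma dft_residual_bounds:
  fixes p q :: "real \<Rightarrow> real" and A B :: real
  assumes N: "N > 0" "even N" and x: "x \<in> carrier_vec N"
    and avg: "average p > 0" "average q > 0"
    and A: "\<And>t. \<bar>fluctuation p t\<bar> \<le> A" and B: "\<And>t. \<bar>fluctuation q t\<bar> \<le> B"
  defines "K \<equiv> A * real N / (2 * sqrt (average p)) + B / sqrt (average q)"
    and "l \<equiv> \<lambda>k. node2 p q (wave_number N k)"
  shows "L2_set (\<lambda>k. cmod (dft_residual p q N x k)) {..<N}
      \<le> K * L2_set (\<lambda>k. sqrt (l k) * cmod ((dft_mat N *\<^sub>v x) $ k)) {..<N}" (is ?growth)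
    and "L2_set (\<lambda>k. cmod (dft_residual p q N x k) / sqrt (l k)) {..<N}
      \<le> K * vec_L2 N (dft_mat N *\<^sub>v x)" (is ?smoothed)
proof -
  let ?F = "dft_mat N" and ?D = "fourier_diff_mat N" and ?w = "\<lambda>k. real_of_int (wave_number N k)"
  let ?P = "grid_diag N (fluctuation p)" and ?Q = "grid_diag N (fluctuation q)"
  let ?rp = "sqrt (average p)" and ?rq = "sqrt (average q)"
  let ?Y = "L2_set (\<lambda>k. sqrt (l k) * cmod ((?F *\<^sub>v x) $ k)) {..<N}"
  have A0: "0 \<le> A" and B0: "0 \<le> B" using A[of 0] B[of 0] by linarith+
  have r: "0 < ?rp" "0 < ?rq" using avg by simp_all
  have lq: "?rq \<le> sqrt (l k)" and lp: "?rp * \<bar>?w k\<bar> \<le> sqrt (l k)" and l0: "0 < sqrt (l k)" for k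
    unfolding l_def by (rule sqrt_node2_bounds[OF avg])+
  have Dx: "?D *\<^sub>v x \<in> carrier_vec N" by (rule mult_mat_vec_carrier[OF fourier_diff_mat_carrier[OF N(1)] x])
  have P: "vec_L2 N (?F *\<^sub>v (?P *\<^sub>v (?D *\<^sub>v x))) \<le> A * vec_L2 N (?F *\<^sub>v (?D *\<^sub>v x))"
    by (rule vec_L2_dft_grid_diag[OF N(1) Dx A])
  have Q: "vec_L2 N (?F *\<^sub>v (?Q *\<^sub>v x)) \<le> B * vec_L2 N (?F *\<^sub>v x)"
    by (rule vec_L2_dft_grid_diag[OF N(1) x B])
  have FDx: "cmod ((?F *\<^sub>v (?D *\<^sub>v x)) $ k) = \<bar>?w k\<bar> * cmod ((?F *\<^sub>v x) $ k)" if "k < N" for k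
    unfolding dft_fourier_diff_mat[OF N(1) x that] by (simp add: norm_mult)
  have res: "cmod (dft_residual p q N x k)
      \<le> cmod ((?F *\<^sub>v (?Q *\<^sub>v x)) $ k) + \<bar>?w k\<bar> * cmod ((?F *\<^sub>v (?P *\<^sub>v (?D *\<^sub>v x))) $ k)" for k
    unfolding dft_residual_def by (rule order_trans[OF norm_triangle_ineq4]) (simp add: norm_mult)
  have wN: "\<bar>?w k\<bar> \<le> real N / 2" if "k < N" for k by (rule wave_number_bound[OF N(2) that])

  \<comment> \<open>For the first estimate the weight on x absorbs the inner derivative; the outer
    one costs N/2 below.\<close>
  have "vec_L2 N (?F *\<^sub>v (?D *\<^sub>v x)) \<le> 1 / ?rp * ?Y"
  proof (rule L2_set_leq_mult)
    fix k assume "k \<in> {..<N}"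
    moreover have "\<bar>?w k\<bar> \<le> 1 / ?rp * sqrt (l k)"
      using lp[of k] r by (simp add: pos_le_divide_eq mult.commute)
    ultimately show "cmod ((?F *\<^sub>v (?D *\<^sub>v x)) $ k) \<le> 1 / ?rp * (sqrt (l k) * cmod ((?F *\<^sub>v x) $ k))"
      using mult_right_mono[OF _ norm_ge_zero] FDx by (metis lessThan_iff mult.assoc)
  qed (use r in simp_all)
  note DY = order_trans[OF P mult_left_mono[OF this A0]]
  have "vec_L2 N (?F *\<^sub>v x) \<le> 1 / ?rq * ?Y"
  proof (rule L2_set_leq_mult)
    fix k
    have "1 \<le> 1 / ?rq * sqrt (l k)" using lq[of k] r by (simp add: pos_le_divide_eq)
    then show "cmod ((?F *\<^sub>v x) $ k) \<le> 1 / ?rq * (sqrt (l k) * cmod ((?F *\<^sub>v x) $ k))"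
      using mult_right_mono[OF _ norm_ge_zero] by (metis mult_1 mult.assoc)
  qed (use r in simp_all)
  note QY = order_trans[OF Q mult_left_mono[OF this B0]]
  have "L2_set (\<lambda>k. \<bar>?w k\<bar> * cmod ((?F *\<^sub>v (?P *\<^sub>v (?D *\<^sub>v x))) $ k)) {..<N}
      \<le> real N / 2 * vec_L2 N (?F *\<^sub>v (?P *\<^sub>v (?D *\<^sub>v x)))"
    by (rule L2_set_leq_mult[OF _ mult_right_mono[OF wN norm_ge_zero]]) simp_all
  also have "\<dots> \<le> real N / 2 * (A * (1 / ?rp * ?Y))"
    using DY by (intro mult_left_mono) simp_all
  finally have wPY: "L2_set (\<lambda>k. \<bar>?w k\<bar> * cmod ((?F *\<^sub>v (?P *\<^sub>v (?D *\<^sub>v x))) $ k)) {..<N}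
      \<le> real N / 2 * (A * (1 / ?rp * ?Y))" .
  have "L2_set (\<lambda>k. cmod (dft_residual p q N x k)) {..<N}
      \<le> vec_L2 N (?F *\<^sub>v (?Q *\<^sub>v x))
        + L2_set (\<lambda>k. \<bar>?w k\<bar> * cmod ((?F *\<^sub>v (?P *\<^sub>v (?D *\<^sub>v x))) $ k)) {..<N}"
    using res by (intro order_trans[OF L2_set_mono L2_set_triangle_ineq]) (auto simp del: index_mult_mat_vec)
  also have "\<dots> \<le> B * (1 / ?rq * ?Y) + real N / 2 * (A * (1 / ?rp * ?Y))"
    by (rule add_mono[OF QY wPY])
  also have "\<dots> = K * ?Y" unfolding K_def by (simp add: algebra_simps del: index_mult_mat_vec)
  finally show ?growth .

  \<comment> \<open>The roles are exchanged: x has no weight, so the inner derivative costs N/2, and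
    the division by sqrt(l) absorbs the outer one.\<close>
  have "vec_L2 N (?F *\<^sub>v (?D *\<^sub>v x)) \<le> real N / 2 * vec_L2 N (?F *\<^sub>v x)"
  proof (rule L2_set_leq_mult)
    fix k assume "k \<in> {..<N}"
    then have "k < N" by simp
    from mult_right_mono[OF wN[OF this] norm_ge_zero] FDx[OF this]
    show "cmod ((?F *\<^sub>v (?D *\<^sub>v x)) $ k) \<le> real N / 2 * cmod ((?F *\<^sub>v x) $ k)" by metis
  qed simp_all
  note DX = order_trans[OF P mult_left_mono[OF this A0]]
  have res': "cmod (dft_residual p q N x k) / sqrt (l k)
      \<le> 1 / ?rq * cmod ((?F *\<^sub>v (?Q *\<^sub>v x)) $ k) + 1 / ?rp * cmod ((?F *\<^sub>v (?P *\<^sub>v (?D *\<^sub>v x))) $ k)" for k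
  proof -
    have "1 / sqrt (l k) \<le> 1 / ?rq" using lq[of k] r by (intro divide_left_mono) auto
    moreover have "\<bar>?w k\<bar> / sqrt (l k) \<le> 1 / ?rp" using lp[of k] l0[of k] r
      by (simp add: divide_simps mult.commute)
    ultimately have "1 / sqrt (l k) * cmod ((?F *\<^sub>v (?Q *\<^sub>v x)) $ k)
        + \<bar>?w k\<bar> / sqrt (l k) * cmod ((?F *\<^sub>v (?P *\<^sub>v (?D *\<^sub>v x))) $ k)
      \<le> 1 / ?rq * cmod ((?F *\<^sub>v (?Q *\<^sub>v x)) $ k) + 1 / ?rp * cmod ((?F *\<^sub>v (?P *\<^sub>v (?D *\<^sub>v x))) $ k)"
      by (intro add_mono mult_right_mono) (auto simp del: index_mult_mat_vec)
    then show ?thesis using divide_right_mono[OF res[of k] less_imp_le[OF l0[of k]]]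
      by (simp add: add_divide_distrib del: index_mult_mat_vec)
  qed
  have "L2_set (\<lambda>k. cmod (dft_residual p q N x k) / sqrt (l k)) {..<N}
      \<le> L2_set (\<lambda>k. 1 / ?rq * cmod ((?F *\<^sub>v (?Q *\<^sub>v x)) $ k)
          + 1 / ?rp * cmod ((?F *\<^sub>v (?P *\<^sub>v (?D *\<^sub>v x))) $ k)) {..<N}"
    by (intro L2_set_mono res' divide_nonneg_pos norm_ge_zero l0)
  also have "\<dots> \<le> 1 / ?rq * vec_L2 N (?F *\<^sub>v (?Q *\<^sub>v x)) + 1 / ?rp * vec_L2 N (?F *\<^sub>v (?P *\<^sub>v (?D *\<^sub>v x)))"
    by (rule order_trans[OF L2_set_triangle_ineq])
      (use r in \<open>simp only: L2_set_right_distrib zero_le_divide_iff zero_le_one less_imp_le simp_thms order_refl\<close>)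
  also have "\<dots> \<le> 1 / ?rq * (B * vec_L2 N (?F *\<^sub>v x)) + 1 / ?rp * (A * (real N / 2 * vec_L2 N (?F *\<^sub>v x)))"
    using r by (intro add_mono mult_left_mono Q DX) simp_all
  also have "\<dots> = K * vec_L2 N (?F *\<^sub>v x)" unfolding K_def by (simp add: algebra_simps del: index_mult_mat_vec)
  finally show ?smoothed .
qed

section \<open>Energy growth in one time step\<close>

lemma kss_step_mode:
  fixes p q :: "real \<Rightarrow> real"
  assumes N: "N > 0" and u: "u \<in> carrier_vec N" and v: "v \<in> carrier_vec N" and k: "k < N"
    and dt: "dt > 0" and l: "node2 p q (wave_number N k) > 0"
  shows "norm (energy_mode p q N
      (kss_block p q N dt 1 1 *\<^sub>v u + kss_block p q N dt 1 2 *\<^sub>v v)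
      (kss_block p q N dt 2 1 *\<^sub>v u + kss_block p q N dt 2 2 *\<^sub>v v) k)
    \<le> norm (energy_mode p q N u v k) + (2 * dt * cmod (dft_residual p q N u k)
      + 3 * dt * (cmod (dft_residual p q N v k) / sqrt (node2 p q (wave_number N k))))"
proof -
  let ?F = "dft_mat N" and ?S = "kss_block p q N dt" and ?\<omega> = "wave_number N k"
  define s where "s = sqrt (node2 p q ?\<omega>)"
  have s: "s > 0" and ls: "node2 p q ?\<omega> = s\<^sup>2" using l by (auto simp: s_def)
  let ?ru = "dft_residual p q N u k" and ?rv = "dft_residual p q N v k"
  define a b where "a = of_real s * (?F *\<^sub>v u) $ k" and "b = (?F *\<^sub>v v) $ k"
  \<comment> \<open>At the node 0 the cosine is 1, \<open>f_12\<close> is dt and the (2,1) function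
    is 0; hence the terms -1 and -dt, and the (2,1) slope is just \<open>- M21\<close>.\<close>
  define M11 M12 M21 where "M11 = (cos (s * dt) - 1) / s\<^sup>2" and "M12 = (sin (s * dt) / s - dt) / s\<^sup>2"
    and "M21 = sin (s * dt) / s"
  have f: "kss_fun 1 1 dt (s\<^sup>2) = cos (s * dt)" "kss_fun 2 2 dt (s\<^sup>2) = cos (s * dt)"
      "kss_fun 1 2 dt (s\<^sup>2) = sin (s * dt) / s" "kss_fun 2 1 dt (s\<^sup>2) = - s * sin (s * dt)"
    and M: "kss_slope p q dt 1 1 ?\<omega> = M11" "kss_slope p q dt 2 2 ?\<omega> = M11"
      "kss_slope p q dt 1 2 ?\<omega> = M12" "kss_slope p q dt 2 1 ?\<omega> = - M21"
    unfolding kss_slope_def ls M11_def M12_def M21_def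
    using s by (simp_all add: kss_fun_def f_diag_def f_12_def node1_def power2_eq_square real_sqrt_mult)
  have S: "(?F *\<^sub>v (?S i 1 *\<^sub>v u + ?S i 2 *\<^sub>v v)) $ k
      = of_real (kss_fun i 1 dt (s\<^sup>2)) * (?F *\<^sub>v u) $ k + of_real (kss_slope p q dt i 1 ?\<omega>) * ?ru
        + (of_real (kss_fun i 2 dt (s\<^sup>2)) * b + of_real (kss_slope p q dt i 2 ?\<omega>) * ?rv)" for i
  proof -
    have c: "?S i 1 *\<^sub>v u \<in> carrier_vec N" "?S i 2 *\<^sub>v v \<in> carrier_vec N"
      using mult_mat_vec_carrier[OF kss_block_carrier[OF N]] u v by blast+
    have "(?F *\<^sub>v (?S i 1 *\<^sub>v u + ?S i 2 *\<^sub>v v)) $ k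
        = (?F *\<^sub>v (?S i 1 *\<^sub>v u)) $ k + (?F *\<^sub>v (?S i 2 *\<^sub>v v)) $ k"
      unfolding mult_add_distrib_mat_vec[OF dft_mat_carrier c]
      using k carrier_matD(1)[OF dft_mat_carrier[of N]] by (simp del: index_mult_mat_vec)
    then show ?thesis
      unfolding dft_kss_block[OF N u k] dft_kss_block[OF N v k] ls b_def .
  qed
  have scale: "cmod (of_real r * z) \<le> c * cmod z" if "\<bar>r\<bar> \<le> c" for r c :: real and z :: complex
    using mult_right_mono[OF that norm_ge_zero] by (simp only: norm_mult norm_of_real)
  \<comment> \<open>Scaling the first component by s turns sin/s into sin, and expressing u through
    a turns -s sin into -sin, so the principal part is the rotation of (a, b) by the angle s
    dt.\<close>
  have "energy_mode p q N (?S 1 1 *\<^sub>v u + ?S 1 2 *\<^sub>v v) (?S 2 1 *\<^sub>v u + ?S 2 2 *\<^sub>v v) k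
      = (of_real (cos (s * dt)) * a + of_real (sin (s * dt)) * b,
         of_real (cos (s * dt)) * b - of_real (sin (s * dt)) * a)
        + ((of_real (s * M11) * ?ru, of_real (- M21) * ?ru) + (of_real (s * M12) * ?rv, of_real M11 * ?rv))"
    using s unfolding energy_mode_def S f M
    by (simp add: s_def[symmetric] a_def field_simps del: index_mult_mat_vec)
  then have "norm (energy_mode p q N (?S 1 1 *\<^sub>v u + ?S 1 2 *\<^sub>v v) (?S 2 1 *\<^sub>v u + ?S 2 2 *\<^sub>v v) k)
    \<le> norm (a, b) + (norm (of_real (s * M11) * ?ru, of_real (- M21) * ?ru)
      + norm (of_real (s * M12) * ?rv, of_real M11 * ?rv))"
    by (simp only:) (rule order_trans[OF norm_triangle_ineq],
        unfold norm_rotation, rule add_left_mono[OF norm_triangle_ineq])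
  \<comment> \<open>The norm of a pair is at most the sum of the norms of its components.
    \<open>M11\<close> and \<open>M21\<close> give dt + dt on the residual of u; \<open>M12\<close>
    and \<open>M11\<close> give 2 dt/s + dt/s on that of v. These are the constants 2 and 3.\<close>
  moreover have "norm (of_real (s * M11) * ?ru, of_real (- M21) * ?ru) \<le> dt * cmod ?ru + dt * cmod ?ru"
    using slope_bounds(1,4)[OF s dt, folded M11_def M21_def]
    by (intro order_trans[OF norm_Pair_le add_mono] scale) (simp_all only: abs_minus_cancel)
  moreover have "norm (of_real (s * M12) * ?rv, of_real M11 * ?rv)
      \<le> 2 * dt / s * cmod ?rv + dt / s * cmod ?rv"
    using slope_bounds(2,3)[OF s dt, folded M11_def M12_def]
    by (intro order_trans[OF norm_Pair_le add_mono] scale)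
  moreover have "norm (energy_mode p q N u v k) = norm (a, b)"
    by (simp only: energy_mode_def a_def b_def s_def)
  moreover have "3 * dt * (cmod ?rv / s) = 2 * dt / s * cmod ?rv + dt / s * cmod ?rv"
    by (simp add: field_simps)
  ultimately show ?thesis unfolding s_def[symmetric] by linarith
qed

text \<open>Minkowski's inequality sums the bound of \<open>kss_step_mode\<close> over all modes.
  The right-hand sides of \<open>dft_residual_bounds\<close> involve a single component of the
  energy modes each, hence are at most \<open>K\<close> times the total energy norm, and 2 + 3 =
  5.\<close>

lemma kss_step_energy:
  fixes p q :: "real \<Rightarrow> real" and A B :: real
  assumes N: "N > 0" "even N" and dt: "dt > 0" and w: "w \<in> carrier_vec (2 * N)"
    and avg: "average p > 0" "average q > 0"
    and A: "\<And>t. \<bar>fluctuation p t\<bar> \<le> A" and B: "\<And>t. \<bar>fluctuation q t\<bar> \<le> B"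
  defines "K \<equiv> A * real N / (2 * sqrt (average p)) + B / sqrt (average q)"
  shows "C_norm p q N (kss_mat p q N dt *\<^sub>v w) \<le> (1 + 5 * K * dt) * C_norm p q N w"
proof -
  let ?F = "dft_mat N" and ?S = "kss_block p q N dt" and ?l = "\<lambda>k. node2 p q (wave_number N k)"
  define u v where "u = vec_first w N" and "v = vec_last w N"
  have u: "u \<in> carrier_vec N" and v: "v \<in> carrier_vec N" by (simp_all add: u_def v_def)
  have wuv: "w = u @\<^sub>v v" using w by (simp add: u_def v_def mult_2)
  let ?u = "?S 1 1 *\<^sub>v u + ?S 1 2 *\<^sub>v v" and ?v = "?S 2 1 *\<^sub>v u + ?S 2 2 *\<^sub>v v"
  note blk = kss_block_carrier[OF N(1), of p q dt]
  have u': "?u \<in> carrier_vec N" and v': "?v \<in> carrier_vec N"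
    using u v by (auto intro!: add_carrier_vec mult_mat_vec_carrier[OF blk])
  have Sw: "kss_mat p q N dt *\<^sub>v w = ?u @\<^sub>v ?v"
    unfolding kss_mat_def wuv by (rule four_block_mat_mult_vec[OF blk blk blk blk u v])
  have l: "0 < ?l k" for k using sqrt_node2_bounds(3)[OF avg] by simp
  define Z where "Z = L2_set (\<lambda>k. norm (energy_mode p q N u v k)) {..<N}"
  have K0: "0 \<le> K" using A[of 0] B[of 0] avg unfolding K_def
    by (intro add_nonneg_nonneg divide_nonneg_pos mult_nonneg_nonneg) auto
  have "L2_set (\<lambda>k. cmod (dft_residual p q N u k)) {..<N}
      \<le> K * L2_set (\<lambda>k. sqrt (?l k) * cmod ((?F *\<^sub>v u) $ k)) {..<N}"
    unfolding K_def by (rule dft_residual_bounds(1)[OF N u avg A B])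
  also have "\<dots> \<le> K * Z" unfolding Z_def energy_mode_def
    using l K0 by (intro mult_left_mono L2_set_mono order_trans[OF _ norm_fst_le])
      (auto simp: norm_mult less_imp_le simp del: index_mult_mat_vec)
  finally have ru: "L2_set (\<lambda>k. cmod (dft_residual p q N u k)) {..<N} \<le> K * Z" .
  have "L2_set (\<lambda>k. cmod (dft_residual p q N v k) / sqrt (?l k)) {..<N} \<le> K * vec_L2 N (?F *\<^sub>v v)"
    unfolding K_def by (rule dft_residual_bounds(2)[OF N v avg A B])
  also have "\<dots> \<le> K * Z" unfolding Z_def energy_mode_def
    using K0 by (intro mult_left_mono L2_set_mono norm_snd_le) auto
  finally have rv: "L2_set (\<lambda>k. cmod (dft_residual p q N v k) / sqrt (?l k)) {..<N} \<le> K * Z" .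
  have "L2_set (\<lambda>k. norm (energy_mode p q N ?u ?v k)) {..<N}
      \<le> L2_set (\<lambda>k. norm (energy_mode p q N u v k) + (2 * dt * cmod (dft_residual p q N u k)
          + 3 * dt * (cmod (dft_residual p q N v k) / sqrt (?l k)))) {..<N}"
    by (intro L2_set_mono kss_step_mode[OF N(1) u v _ dt l]) auto
  also have "\<dots> \<le> Z + (L2_set (\<lambda>k. 2 * dt * cmod (dft_residual p q N u k)) {..<N}
      + L2_set (\<lambda>k. 3 * dt * (cmod (dft_residual p q N v k) / sqrt (?l k))) {..<N})"
    unfolding Z_def
    by (intro order_trans[OF L2_set_triangle_ineq] add_left_mono L2_set_triangle_ineq)
  also have "\<dots> = Z + (2 * dt * L2_set (\<lambda>k. cmod (dft_residual p q N u k)) {..<N}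
      + 3 * dt * L2_set (\<lambda>k. cmod (dft_residual p q N v k) / sqrt (?l k)) {..<N})"
    using dt by (simp only: L2_set_right_distrib)
  also have "\<dots> \<le> Z + (2 * dt * (K * Z) + 3 * dt * (K * Z))"
    using dt by (intro add_left_mono add_mono mult_left_mono ru rv) auto
  also have "\<dots> = (1 + 5 * K * dt) * Z" by (simp add: algebra_simps)
  finally have "sqrt (real N) * L2_set (\<lambda>k. norm (energy_mode p q N ?u ?v k)) {..<N}
      \<le> sqrt (real N) * ((1 + 5 * K * dt) * Z)" by (rule mult_left_mono) simp
  then show ?thesis
    unfolding Sw unfolding wuv C_norm_append[OF N(1) u v less_imp_le[OF l]]
      C_norm_append[OF N(1) u' v' less_imp_le[OF l]] Z_def
    by (simp only: mult.left_commute)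
qed

section \<open>The operator norm bound\<close>

text \<open>Boundedness makes the real-valued supremum a genuine upper bound; subtracting the
  average only shifts the range.\<close>

lemma fluctuation_le_sup_norm:
  assumes "bounded (range f)"
  shows "\<bar>fluctuation f x\<bar> \<le> sup_norm (fluctuation f)"
proof -
  obtain B where B: "\<And>x. \<bar>f x\<bar> \<le> B" using assms by (auto simp: bounded_iff)
  have "\<bar>fluctuation f x\<bar> \<le> B + \<bar>average f\<bar>" for x
    using B[of x] by (simp add: fluctuation_def)
  then show ?thesis unfolding sup_norm_def by (intro cSUP_upper bdd_aboveI2) auto
qed

theorem theorem3p3:
  fixes p q :: "real \<Rightarrow> real"
  assumes p_periodic: "\<And>x. p (x + 2 * pi) = p x"
    and q_periodic: "\<And>x. q (x + 2 * pi) = q x"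
    and p_integrable: "p integrable_on {0..2 * pi}"
    and q_integrable: "q integrable_on {0..2 * pi}"
    and p_bounded: "bounded (range p)"
    and q_bounded: "bounded (range q)"
    and p_pos: "\<And>x. p x > 0"
    and q_nonneg: "\<And>x. q x \<ge> 0"
    and q_average_pos: "average q > 0"
    and bandlimited: "\<exists>\<omega>\<^sub>m\<^sub>a\<^sub>x :: nat. \<forall>\<omega> :: int. \<bar>\<omega>\<bar> > int \<omega>\<^sub>m\<^sub>a\<^sub>x \<longrightarrow>
        fourier_coeff p \<omega> = 0 \<and> fourier_coeff q \<omega> = 0"
  shows "\<exists>C\<^sub>p C\<^sub>q :: real. \<forall>N :: nat. \<forall>dt :: real. even N \<and> N > 0 \<and> dt > 0 \<longrightarrow>
    C_op_norm p q N (kss_mat p q N dt)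
      \<le> 1 + (C\<^sub>p * sup_norm (fluctuation p) * real N + C\<^sub>q * sup_norm (fluctuation q)) * dt"
proof (intro exI allI impI)
  \<comment> \<open>These are the coefficients of \<open>5 * K\<close> from
    \<open>kss_step_energy\<close>; they depend on the averages of p and q only.\<close>
  let ?Cp = "5 / (2 * sqrt (average p))" and ?Cq = "5 / sqrt (average q)"
  let ?A = "sup_norm (fluctuation p)" and ?B = "sup_norm (fluctuation q)"
  fix N :: nat and dt :: real
  assume "even N \<and> N > 0 \<and> dt > 0"
  then have N: "N > 0" "even N" and dt: "dt > 0" by auto
  let ?V = "carrier_vec (2 * N) - {0\<^sub>v (2 * N)} :: complex vec set"
  let ?R = "1 + (?Cp * ?A * real N + ?Cq * ?B) * dt"
  note avg = average_pos[OF p_integrable p_pos] q_average_pos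
  note A = fluctuation_le_sup_norm[OF p_bounded] and B = fluctuation_le_sup_norm[OF q_bounded]
  have AB: "0 \<le> ?A" "0 \<le> ?B" using A[of 0] B[of 0] by linarith+
  have R0: "0 \<le> ?R" using avg AB dt by simp
  \<comment> \<open>In HOL \<open>sqrt\<close> of a negative number is negative, so the sign is read
    off from the formula in Fourier modes.\<close>
  have C0: "0 \<le> C_norm p q N w" if "w \<in> ?V" for w
  proof -
    have "w = vec_first w N @\<^sub>v vec_last w N" using that by (simp add: mult_2)
    then show ?thesis
      using C_norm_append[OF N(1) vec_first_carrier vec_last_carrier, of p q w w]
        sqrt_node2_bounds(3)[OF avg] by (metis L2_set_nonneg less_imp_le mult_nonneg_nonneg
          of_nat_0_le_iff real_sqrt_ge_zero real_sqrt_gt_0_iff)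
  qed
  have "unit_vec (2 * N) 0 \<in> ?V" using N by simp
  then have "?V \<noteq> {}" by blast
  then show "C_op_norm p q N (kss_mat p q N dt) \<le> ?R"
    unfolding C_op_norm_def
  proof (rule cSUP_least)
    fix w assume w: "w \<in> ?V"
    have "C_norm p q N (kss_mat p q N dt *\<^sub>v w) \<le> ?R * C_norm p q N w"
      using kss_step_energy[OF N dt _ avg A B, of w] w by (simp add: algebra_simps)
    \<comment> \<open>If the denominator is 0, the quotient is 0 by convention and \<open>R0\<close>
      applies; so nonnegativity of the norm suffices here.\<close>
    then show "C_norm p q N (kss_mat p q N dt *\<^sub>v w) / C_norm p q N w \<le> ?R"
      using C0[OF w] R0 by (cases "C_norm p q N w = 0") (auto simp: divide_le_eq)
  qed
qed

end
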